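(* Let $g_1<g_2$ be positive integers such that $\frac{g_2}{2}<g_1$ and such that at least one of the following holds: $(g_2-g_1)\mid g_2$, or $(2g_1-g_2)\nmid g_2$. Identify each element of $\mathcal{I}(g_1)$ with its Kunz-coordinates vector in $\{0,1\}^{g_1}$ and each element of $\mathcal{I}(g_2)$ with its Kunz-coordinates vector in $\{0,1\}^{g_2}$. Define $$A=\{(x_1,\ldots,x_{g_1},0,\ldots,0)\in\{0,1\}^{g_2} \mid (x_1,\ldots,x_{g_1})\in\mathcal{I}(g_1)\},$$ $$B_0=\{(x_1,\ldots,x_{g_2})\in\mathcal{I}(g_2)\mid x_{g_1}=0\},\qquad B_1=\{(x_1,\ldots,x_{g_2})\in\mathcal{I}(g_2)\mid x_{g_1}=1\},$$ $$C=\mathrm{minimals}\{a\vee b\mid a\in A \text{ and } b\in B_0\},\qquad D=\{c\in C\mid b\vee c\neq c \text{ for all } b\in B_1\}.$$ Then $D$ is exactly the set of Kunz-coordinates vectors (in $\{0,1\}^{g_2}$) of the elements of the set $\{S\mid S \text{ is a numerical semigroup and } \mathrm{E}(S)=\{g_1,g_2\}\}$.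
   Context: $\mathbb{N}$ denotes the set of non-negative integers. A numerical semigroup is a subset $S\subseteq\mathbb{N}$ that is closed under addition, contains $0$, and has finite complement $\mathbb{N}\setminus S$. The Frobenius number $\mathrm{F}(S)$ is the greatest integer not belonging to $S$. A numerical semigroup is irreducible if it cannot be expressed as the intersection of two numerical semigroups containing it properly. For a positive integer $F$, $\mathcal{I}(F)$ is the set of all irreducible numerical semigroups with Frobenius number $F$. The set of special gaps of $S$ is $$\mathrm{E}(S)=\{x\in\mathbb{N}\setminus S \mid 2x\in S \text{ and } x+s\in S \text{ for all } s\in S\setminus\{0\}\}.$$ A numerical semigroup $S$ with Frobenius number $F$ is represented by its Kunz-coordinates vector $(x_1,\ldots,x_F)\in\{0,1\}^F$, where $x_i=0$ if and only if $i\in S$. (If $\mathrm{E}(S)=\{g_1,g_2\}$ with $g_1<g_2$, then $\mathrm{F}(S)=g_2$.) For $(a_1,\ldots,a_n),(b_1,\ldots,b_n)\in\mathbb{N}^n$, $(a_1,\ldots,a_n)\vee(b_1,\ldots,b_n)=(\max\{a_1,b_1\},\ldots,\max\{a_n,b_n\})$. For $X\subseteq\mathbb{N}^n$, $\mathrm{minimals}(X)$ is the set of minimal elements of $X$ with respect to the usual component-wise order. *)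

theory Defs
  imports Complex_Main
begin

definition numerical_semigroup :: "nat set \<Rightarrow> bool" where
  "numerical_semigroup S \<longleftrightarrow>
     0 \<in> S \<and> (\<forall>x\<in>S. \<forall>y\<in>S. x + y \<in> S) \<and> finite (UNIV - S)"

(* The greatest integer outside S, hence -1 for S = UNIV.  The value is unspecified
   when S has infinite complement. *)
definition frobenius_number :: "nat set \<Rightarrow> int" where
  "frobenius_number S = (GREATEST z. z \<notin> int ` S)"

definition irreducible_semigroup :: "nat set \<Rightarrow> bool" where
  "irreducible_semigroup S \<longleftrightarrow> numerical_semigroup S \<and>
     \<not> (\<exists>T U. numerical_semigroup T \<and> numerical_semigroup U \<and>
            S \<subset> T \<and> S \<subset> U \<and> S = T \<inter> U)"

definition irreducibles_with_frobenius :: "nat \<Rightarrow> nat set set" where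
  "irreducibles_with_frobenius F =
     {S. irreducible_semigroup S \<and> frobenius_number S = int F}"

definition special_gaps :: "nat set \<Rightarrow> nat set" where
  "special_gaps S = {x. x \<notin> S \<and> 2 * x \<in> S \<and> (\<forall>s\<in>S - {0}. x + s \<in> S)}"

(* Vectors in N^n are lists of length n.  Lists are indexed from 0, so the
   coordinate x_i (1 <= i <= n) of x is the list entry x ! (i - 1). *)
definition kunz_vector :: "nat \<Rightarrow> nat set \<Rightarrow> nat list" where
  "kunz_vector F S = map (\<lambda>i. if i \<in> S then 0 else 1) [1..<F + 1]"

(* Only meant for vectors of equal length. *)
definition vec_join :: "nat list \<Rightarrow> nat list \<Rightarrow> nat list" where
  "vec_join a b = map2 max a b"

definition minimals :: "nat list set \<Rightarrow> nat list set" where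
  "minimals X = {x \<in> X. \<forall>y\<in>X. list_all2 (\<le>) y x \<longrightarrow> y = x}"

end

theory Submission
  imports Defs
begin

text \<open>
  Passing to the sets represented by Kunz vectors turns joins into intersections and the
  component-wise order into reverse inclusion.  So \<open>C\<close> consists of the maximal sets among the
  intersections \<open>S\<^sub>1 \<inter> S\<^sub>2\<close>, where \<open>S\<^sub>1\<close> is irreducible with Frobenius number \<open>g\<^sub>1\<close> and \<open>S\<^sub>2\<close> is
  irreducible with Frobenius number \<open>g\<^sub>2\<close> and contains \<open>g\<^sub>1\<close>; and \<open>D\<close> consists of those that lie in
  no irreducible semigroup with Frobenius number \<open>g\<^sub>2\<close> that misses \<open>g\<^sub>1\<close>.

  Three facts carry the argument.  The irreducible semigroups with Frobenius number \<open>F\<close> are the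
  numerical semigroups that are maximal among those avoiding \<open>F\<close>
  (\<open>irreducibles_with_frobenius_eq\<close>); every numerical semigroup avoiding \<open>F\<close> lies in such a
  maximal one (\<open>ex_maximal_avoiding\<close>); and every numerical semigroup that properly contains \<open>S\<close>
  contains a special gap of \<open>S\<close> (\<open>special_gap_in_proper_superset\<close>), while adjoining a single
  special gap to \<open>S\<close> gives a numerical semigroup again.

  If \<open>E(S) = {g\<^sub>1, g\<^sub>2}\<close>, enlarge \<open>S\<close> to a maximal \<open>S\<^sub>1\<close> avoiding \<open>g\<^sub>1\<close> and \<open>S \<union> {g\<^sub>1}\<close> to a maximal
  \<open>S\<^sub>2\<close> avoiding \<open>g\<^sub>2\<close>.  Then \<open>S\<^sub>1 \<inter> S\<^sub>2\<close> contains \<open>S\<close> but no special gap of \<open>S\<close>, so it equals \<open>S\<close>.  The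
  same reasoning shows that \<open>S\<close> is maximal among such intersections and that no numerical
  semigroup containing \<open>S\<close> and missing both \<open>g\<^sub>1\<close> and \<open>g\<^sub>2\<close> is larger than \<open>S\<close>.
  As \<open>S \<union> {g\<^sub>1}\<close> is a numerical semigroup, \<open>S\<close> itself is not maximal avoiding \<open>g\<^sub>2\<close>.

  Conversely, let \<open>S\<close> be represented in \<open>D\<close>.  Were \<open>h\<close> a special gap other than \<open>g\<^sub>1\<close> and \<open>g\<^sub>2\<close>,
  one would enlarge \<open>S \<union> {h}\<close> to a maximal \<open>T\<^sub>1\<close> avoiding \<open>g\<^sub>1\<close> and to a maximal \<open>T\<^sub>2\<close> avoiding \<open>g\<^sub>2\<close>.
  By the definition of \<open>D\<close>, \<open>T\<^sub>2\<close> contains \<open>g\<^sub>1\<close>, and then \<open>T\<^sub>1 \<inter> T\<^sub>2\<close> contradicts the maximality of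
  \<open>S\<close>.  Hence \<open>E(S) \<subseteq> {g\<^sub>1, g\<^sub>2}\<close>.  Extending \<open>S\<close> to a maximal semigroup avoiding \<open>g\<^sub>2\<close>, which contains
  \<open>g\<^sub>1\<close>, shows that \<open>g\<^sub>1\<close> is a special gap, and \<open>g\<^sub>2\<close> is one because it is the largest gap.
\<close>

section \<open>Special gaps and oversemigroups\<close>

lemma numerical_semigroup_Int:
  assumes "numerical_semigroup S" "numerical_semigroup T"
  shows "numerical_semigroup (S \<inter> T)"
  using assms by (auto simp: numerical_semigroup_def Diff_Int)

lemma numerical_semigroup_Un_greaterThan:
  assumes "numerical_semigroup S"
  shows "numerical_semigroup (S \<union> {F<..})"
proof -
  have "finite (UNIV - (S \<union> {F<..}))"
    using assms by (auto simp: numerical_semigroup_def intro: finite_subset[of _ "UNIV - S"])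
  then show ?thesis
    using assms by (auto simp: numerical_semigroup_def)
qed

lemma numerical_semigroup_insert_special_gap:
  assumes S: "numerical_semigroup S" and x: "x \<in> special_gaps S"
  shows "numerical_semigroup (insert x S)"
proof -
  have "x + s \<in> insert x S" if "s \<in> S" for s
    using x that by (cases "s = 0") (auto simp: special_gaps_def)
  moreover have "x + x \<in> S"
    using x by (simp add: special_gaps_def mult_2)
  moreover have "finite (UNIV - insert x S)"
    using S by (auto simp: numerical_semigroup_def intro: finite_subset[of _ "UNIV - S"])
  ultimately show ?thesis
    using S by (auto simp: numerical_semigroup_def add.commute)
qed

lemma largest_gap_is_special:
  assumes "numerical_semigroup S" "F \<notin> S" "{F<..} \<subseteq> S"
  shows "F \<in> special_gaps S"
proof -
  have "F \<noteq> 0"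
    using assms by (auto simp: numerical_semigroup_def intro: gr0I)
  then show ?thesis
    using assms by (auto simp: special_gaps_def subset_iff)
qed

text \<open>The largest element of the difference is a special gap.\<close>

lemma special_gap_in_proper_superset:
  assumes S: "numerical_semigroup S" and T: "numerical_semigroup T" and "S \<subset> T"
  obtains x where "x \<in> special_gaps S" "x \<in> T"
proof -
  have fin: "finite (T - S)"
    using S by (auto simp: numerical_semigroup_def intro: finite_subset[of _ "UNIV - S"])
  define x where "x = Max (T - S)"
  have x: "x \<in> T" "x \<notin> S"
    using Max_in[OF fin] \<open>S \<subset> T\<close> by (auto simp: x_def)
  have above: "y \<in> S" if "y \<in> T" "x < y" for y
    using Max_ge[OF fin, of y] that by (auto simp: x_def)
  have "x \<noteq> 0"
    using S x by (auto simp: numerical_semigroup_def intro: gr0I)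
  have "x + s \<in> S" if "s \<in> T" "s \<noteq> 0" for s
    using T x that by (intro above) (auto simp: numerical_semigroup_def)
  then have "x \<in> special_gaps S"
    using x \<open>x \<noteq> 0\<close> \<open>S \<subset> T\<close> by (auto simp: special_gaps_def mult_2)
  with x that show thesis by blast
qed

lemma eq_if_no_special_gap:
  assumes "numerical_semigroup S" "numerical_semigroup T" "S \<subseteq> T" "special_gaps S \<inter> T = {}"
  shows "T = S"
  using assms by (blast elim: special_gap_in_proper_superset)

section \<open>Irreducible semigroups as maximal semigroups avoiding a number\<close>

text \<open>The numerical semigroups that are maximal with respect to inclusion among those that do not
  contain \<open>F\<close>.\<close>

definition maximal_avoiding :: "nat \<Rightarrow> nat set \<Rightarrow> bool" where
  "maximal_avoiding F T \<longleftrightarrow> numerical_semigroup T \<and> F \<notin> T \<and>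
     (\<forall>U. numerical_semigroup U \<and> T \<subseteq> U \<and> F \<notin> U \<longrightarrow> U = T)"

lemma maximal_avoiding_greaterThan:
  assumes "maximal_avoiding F T"
  shows "{F<..} \<subseteq> T"
proof -
  have "T \<union> {F<..} = T"
    using assms numerical_semigroup_Un_greaterThan[of T F] by (auto simp: maximal_avoiding_def)
  then show ?thesis by blast
qed

lemma ex_maximal_avoiding:
  assumes "numerical_semigroup S" "F \<notin> S"
  obtains T where "maximal_avoiding F T" "S \<subseteq> T"
proof -
  define P where "P T \<longleftrightarrow> numerical_semigroup T \<and> F \<notin> T \<and> S \<subseteq> T" for T
  have "P S"
    using assms by (simp add: P_def)
  then obtain T where T: "P T" and least: "\<And>U. P U \<Longrightarrow> card (UNIV - T) \<le> card (UNIV - U)"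
    using ex_has_least_nat[of P S "\<lambda>T. card (UNIV - T)"] by blast
  have "U = T" if "numerical_semigroup U" "T \<subseteq> U" "F \<notin> U" for U
  proof (rule ccontr)
    assume "U \<noteq> T"
    then have "UNIV - U \<subset> UNIV - T"
      using that by blast
    moreover have "finite (UNIV - T)"
      using T by (simp add: P_def numerical_semigroup_def)
    ultimately have "card (UNIV - U) < card (UNIV - T)"
      by (rule psubset_card_mono[rotated])
    moreover have "P U"
      using T that by (auto simp: P_def)
    ultimately show False
      using least[of U] by simp
  qed
  then have "maximal_avoiding F T"
    using T by (auto simp: maximal_avoiding_def P_def)
  with T that show thesis
    by (auto simp: P_def)
qed

lemma frobenius_number_eq_iff:
  assumes "numerical_semigroup S"
  shows "frobenius_number S = int F \<longleftrightarrow> F \<notin> S \<and> {F<..} \<subseteq> S"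
proof -
  have eqI: "frobenius_number S = int m" if "m \<notin> S" "{m<..} \<subseteq> S" for m
    unfolding frobenius_number_def
  proof (rule Greatest_equality)
    show "int m \<notin> int ` S"
      using that by auto
  next
    fix z assume z: "z \<notin> int ` S"
    show "z \<le> int m"
    proof (rule ccontr)
      assume "\<not> z \<le> int m"
      then have "nat z \<in> S" "z = int (nat z)"
        using that by auto
      with z show False by blast
    qed
  qed
  show ?thesis
  proof
    assume F: "frobenius_number S = int F"
    have fin: "finite (UNIV - S)"
      using assms by (simp add: numerical_semigroup_def)
    have "S \<noteq> UNIV"
    proof
      assume "S = UNIV"
      \<comment> \<open>For the full semigroup the greatest integer outside is \<open>-1\<close>.\<close>
      have "frobenius_number S = -1"
        unfolding frobenius_number_def
      proof (rule Greatest_equality)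
        show "-1 \<notin> int ` S" by auto
      next
        fix z assume z: "z \<notin> int ` S"
        show "z \<le> -1"
        proof (rule ccontr)
          assume "\<not> z \<le> -1"
          then have "z = int (nat z)" by simp
          with z \<open>S = UNIV\<close> show False by blast
        qed
      qed
      with F show False by simp
    qed
    then have "Max (UNIV - S) \<notin> S"
      using Max_in[OF fin] by auto
    moreover have "{Max (UNIV - S)<..} \<subseteq> S"
      using Max_ge[OF fin] by (force simp: not_le[symmetric])
    ultimately show "F \<notin> S \<and> {F<..} \<subseteq> S"
      using eqI[of "Max (UNIV - S)"] F by simp
  qed (use eqI in blast)
qed

lemma irreducibles_with_frobenius_eq:
  "irreducibles_with_frobenius F = Collect (maximal_avoiding F)"
proof (intro set_eqI iffI)
  fix S assume "S \<in> irreducibles_with_frobenius F"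
  then have S: "numerical_semigroup S" and F: "F \<notin> S" "{F<..} \<subseteq> S"
    and irred: "\<And>T U. numerical_semigroup T \<Longrightarrow> numerical_semigroup U \<Longrightarrow> S \<subset> T \<Longrightarrow> S \<subset> U \<Longrightarrow>
      S \<noteq> T \<inter> U"
    by (auto simp: irreducibles_with_frobenius_def irreducible_semigroup_def
        frobenius_number_eq_iff)
  have insert_F: "numerical_semigroup (insert F S)"
    using S F by (intro numerical_semigroup_insert_special_gap largest_gap_is_special)
  \<comment> \<open>A larger semigroup \<open>T\<close> avoiding \<open>F\<close> would give the decomposition \<open>S = T \<inter> (S \<union> {F})\<close>.\<close>
  have "T = S" if "numerical_semigroup T" "S \<subseteq> T" "F \<notin> T" for T
    using irred[OF that(1) insert_F] that F by blast
  then show "S \<in> Collect (maximal_avoiding F)"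
    using S F by (auto simp: maximal_avoiding_def)
next
  fix S assume "S \<in> Collect (maximal_avoiding F)"
  then have S: "maximal_avoiding F S" by simp
  then have "frobenius_number S = int F"
    using maximal_avoiding_greaterThan[OF S]
    by (subst frobenius_number_eq_iff) (auto simp: maximal_avoiding_def)
  moreover have "irreducible_semigroup S"
    using S unfolding irreducible_semigroup_def maximal_avoiding_def by blast
  ultimately show "S \<in> irreducibles_with_frobenius F"
    by (simp add: irreducibles_with_frobenius_def)
qed

section \<open>Kunz vectors\<close>

lemma length_kunz_vector [simp]: "length (kunz_vector n S) = n"
  by (simp add: kunz_vector_def del: upt_Suc)

text \<open>Lists are indexed from \<open>0\<close>, so entry \<open>i\<close> records membership of \<open>i + 1\<close>.\<close>

lemma kunz_vector_nth [simp]: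
  "i < n \<Longrightarrow> kunz_vector n S ! i = (if Suc i \<in> S then 0 else 1)"
  by (simp add: kunz_vector_def del: upt_Suc)

lemma kunz_vector_append_zeros:
  assumes "{m<..} \<subseteq> S" "m \<le> n"
  shows "kunz_vector m S @ replicate (n - m) 0 = kunz_vector n S"
  using assms by (intro nth_equalityI) (auto simp: nth_append subset_iff)

lemma vec_join_kunz_vector:
  "vec_join (kunz_vector n S) (kunz_vector n T) = kunz_vector n (S \<inter> T)"
  by (rule nth_equalityI) (auto simp: vec_join_def)

lemma kunz_vector_le_iff:
  assumes "0 \<in> S" "{n<..} \<subseteq> S"
  shows "list_all2 (\<le>) (kunz_vector n S) (kunz_vector n T) \<longleftrightarrow> T \<subseteq> S"
proof
  assume le: "list_all2 (\<le>) (kunz_vector n S) (kunz_vector n T)"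
  show "T \<subseteq> S"
  proof
    fix x assume "x \<in> T"
    consider "x = 0" | "n < x" | i where "x = Suc i" "i < n"
      by (cases x; cases "n < x") auto
    then show "x \<in> S"
    proof cases
      case 3
      then have "kunz_vector n S ! i \<le> kunz_vector n T ! i"
        using list_all2_nthD[OF le, of i] by (simp only: length_kunz_vector)
      then show ?thesis
        using 3 \<open>x \<in> T\<close> by (auto split: if_splits)
    qed (use assms in auto)
  qed
qed (auto simp: list_all2_conv_all_nth)

lemma kunz_vector_eq_iff:
  assumes "0 \<in> S" "{n<..} \<subseteq> S" "0 \<in> T" "{n<..} \<subseteq> T"
  shows "kunz_vector n S = kunz_vector n T \<longleftrightarrow> S = T"
proof
  assume "kunz_vector n S = kunz_vector n T"
  then have "list_all2 (\<le>) (kunz_vector n S) (kunz_vector n T)"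
    "list_all2 (\<le>) (kunz_vector n T) (kunz_vector n S)"
    by (simp_all add: list_all2_refl)
  then show "S = T"
    using assms by (simp add: kunz_vector_le_iff)
qed simp

section \<open>Semigroups with two special gaps\<close>

text \<open>The intersections whose Kunz vectors are the joins \<open>a \<or> b\<close> with \<open>a \<in> A\<close> and \<open>b \<in> B\<^sub>0\<close>.\<close>

definition irreducible_meets :: "nat \<Rightarrow> nat \<Rightarrow> nat set set" where
  "irreducible_meets g1 g2 =
     {T1 \<inter> T2 | T1 T2. maximal_avoiding g1 T1 \<and> maximal_avoiding g2 T2 \<and> g1 \<in> T2}"

lemma irreducible_meetsD:
  assumes "S \<in> irreducible_meets g1 g2" "g1 < g2"
  shows "numerical_semigroup S" "g1 \<notin> S" "g2 \<notin> S" "{g2<..} \<subseteq> S"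
proof -
  obtain T1 T2 where T: "S = T1 \<inter> T2" "maximal_avoiding g1 T1" "maximal_avoiding g2 T2"
    using assms by (auto simp: irreducible_meets_def)
  then show "numerical_semigroup S"
    by (simp add: maximal_avoiding_def numerical_semigroup_Int)
  show "g1 \<notin> S" "g2 \<notin> S"
    using T by (auto simp: maximal_avoiding_def)
  show "{g2<..} \<subseteq> S"
    using T(1) T(2,3)[THEN maximal_avoiding_greaterThan] \<open>g1 < g2\<close> by auto
qed

lemma special_gaps_eq_pair_iff:
  assumes "g1 < g2"
  shows "numerical_semigroup S \<and> special_gaps S = {g1, g2} \<longleftrightarrow>
    S \<in> irreducible_meets g1 g2 \<and>
    (\<forall>S'\<in>irreducible_meets g1 g2. S \<subseteq> S' \<longrightarrow> S' = S) \<and>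
    (\<forall>T. maximal_avoiding g2 T \<and> g1 \<notin> T \<longrightarrow> \<not> S \<subseteq> T)"
    (is "?lhs \<longleftrightarrow> ?rhs")
proof
  assume ?lhs
  then have S: "numerical_semigroup S" and gaps: "special_gaps S = {g1, g2}" by auto
  have notin: "g1 \<notin> S" "g2 \<notin> S"
    using gaps by (auto simp: special_gaps_def)
  have insert_g1: "numerical_semigroup (insert g1 S)"
    using S gaps by (intro numerical_semigroup_insert_special_gap) auto
  obtain T1 where T1: "maximal_avoiding g1 T1" "S \<subseteq> T1"
    using ex_maximal_avoiding S notin by blast
  obtain T2 where T2: "maximal_avoiding g2 T2" "insert g1 S \<subseteq> T2"
    using ex_maximal_avoiding[OF insert_g1, of g2] notin \<open>g1 < g2\<close> by auto
  have "T1 \<inter> T2 = S"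
    using S T1 T2 gaps
    by - (rule eq_if_no_special_gap, auto simp: maximal_avoiding_def numerical_semigroup_Int)
  then have "S \<in> irreducible_meets g1 g2"
    using T1 T2 by (auto simp: irreducible_meets_def)
  moreover have "S' = S" if "S' \<in> irreducible_meets g1 g2" "S \<subseteq> S'" for S'
    using irreducible_meetsD[OF that(1) assms] that(2) S gaps
    by - (rule eq_if_no_special_gap, auto)
  moreover have "\<not> S \<subseteq> T" if T: "maximal_avoiding g2 T" "g1 \<notin> T" for T
  proof
    assume "S \<subseteq> T"
    then have "T = S"
      using T S gaps by - (rule eq_if_no_special_gap, auto simp: maximal_avoiding_def)
    moreover have "insert g1 S = T"
      using T insert_g1 notin \<open>g1 < g2\<close> \<open>T = S\<close> unfolding maximal_avoiding_def by blast
    ultimately show False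
      using T by blast
  qed
  ultimately show ?rhs by blast
next
  assume ?rhs
  then have meet: "S \<in> irreducible_meets g1 g2"
    and maximal: "\<And>S'. S' \<in> irreducible_meets g1 g2 \<Longrightarrow> S \<subseteq> S' \<Longrightarrow> S' = S"
    and no_B1: "\<And>T. maximal_avoiding g2 T \<Longrightarrow> S \<subseteq> T \<Longrightarrow> g1 \<in> T"
    by blast+
  note S = irreducible_meetsD[OF meet assms]
  have "h = g1 \<or> h = g2" if h: "h \<in> special_gaps S" for h
  proof (rule ccontr)
    assume neq: "\<not> (h = g1 \<or> h = g2)"
    have insert_h: "numerical_semigroup (insert h S)"
      using S h by (intro numerical_semigroup_insert_special_gap)
    obtain T1 where T1: "maximal_avoiding g1 T1" "insert h S \<subseteq> T1"
      using ex_maximal_avoiding[OF insert_h, of g1] S neq by auto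
    obtain T2 where T2: "maximal_avoiding g2 T2" "insert h S \<subseteq> T2"
      using ex_maximal_avoiding[OF insert_h, of g2] S neq by auto
    have "g1 \<in> T2"
      using T2 by (intro no_B1) auto
    then have "T1 \<inter> T2 \<in> irreducible_meets g1 g2"
      using T1(1) T2(1) by (auto simp: irreducible_meets_def)
    then have "T1 \<inter> T2 = S"
      using T1 T2 by (intro maximal) auto
    then have "h \<in> S"
      using T1 T2 by auto
    with h show False
      by (simp add: special_gaps_def)
  qed
  moreover have "g2 \<in> special_gaps S"
    using S by (intro largest_gap_is_special)
  moreover have "g1 \<in> special_gaps S"
  proof -
    obtain T where T: "maximal_avoiding g2 T" "S \<subseteq> T"
      using ex_maximal_avoiding S by blast
    then have "S \<subset> T"
      using no_B1 S by blast
    then obtain x where "x \<in> special_gaps S" "x \<in> T"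
      using S T special_gap_in_proper_superset[of S T] by (auto simp: maximal_avoiding_def)
    then show ?thesis
      using T calculation(1) by (auto simp: maximal_avoiding_def)
  qed
  ultimately show ?lhs
    using S by auto
qed

theorem mainTheorem2:
  fixes g1 g2 :: nat
    and A B0 B1 C D :: "nat list set"
  assumes "0 < g1" and "g1 < g2" and "real g2 / 2 < real g1"
    and "(int g2 - int g1) dvd int g2 \<or> \<not> (2 * int g1 - int g2) dvd int g2"
    and "A = {x @ replicate (g2 - g1) 0 | x.
                x \<in> kunz_vector g1 ` irreducibles_with_frobenius g1}"
    and "B0 = {x \<in> kunz_vector g2 ` irreducibles_with_frobenius g2. x ! (g1 - 1) = 0}"
    and "B1 = {x \<in> kunz_vector g2 ` irreducibles_with_frobenius g2. x ! (g1 - 1) = 1}"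
    and "C = minimals {vec_join a b | a b. a \<in> A \<and> b \<in> B0}"
    and "D = {c \<in> C. \<forall>b\<in>B1. vec_join b c \<noteq> c}"
  shows "D = kunz_vector g2 ` {S. numerical_semigroup S \<and> special_gaps S = {g1, g2}}"
proof -
  let ?K = "kunz_vector g2"
  let ?M = "irreducible_meets g1 g2"
  have zeros: "kunz_vector g1 T @ replicate (g2 - g1) 0 = ?K T" if "maximal_avoiding g1 T" for T
    using that assms(2) by (intro kunz_vector_append_zeros maximal_avoiding_greaterThan) auto
  have "A = (\<lambda>T. kunz_vector g1 T @ replicate (g2 - g1) 0) ` {T. maximal_avoiding g1 T}"
    unfolding assms(5) irreducibles_with_frobenius_eq by blast
  also have "\<dots> = ?K ` {T. maximal_avoiding g1 T}"
    using zeros by (intro image_cong) auto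
  finally have A: "A = ?K ` {T. maximal_avoiding g1 T}" .
  have nth: "?K T ! (g1 - 1) = 0 \<longleftrightarrow> g1 \<in> T" "?K T ! (g1 - 1) = 1 \<longleftrightarrow> g1 \<notin> T" for T
    using assms(1,2) by simp_all
  have "B0 = ?K ` {T. maximal_avoiding g2 T \<and> ?K T ! (g1 - 1) = 0}"
    unfolding assms(6) irreducibles_with_frobenius_eq by (simp add: Compr_image_eq)
  then have B0: "B0 = ?K ` {T. maximal_avoiding g2 T \<and> g1 \<in> T}"
    by (simp only: nth)
  have "B1 = ?K ` {T. maximal_avoiding g2 T \<and> ?K T ! (g1 - 1) = 1}"
    unfolding assms(7) irreducibles_with_frobenius_eq by (simp add: Compr_image_eq)
  then have B1: "B1 = ?K ` {T. maximal_avoiding g2 T \<and> g1 \<notin> T}"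
    by (simp only: nth)
  have "{vec_join a b | a b. a \<in> A \<and> b \<in> B0} = {vec_join (?K T1) (?K T2) | T1 T2.
      maximal_avoiding g1 T1 \<and> maximal_avoiding g2 T2 \<and> g1 \<in> T2}"
    unfolding A B0 by blast
  also have "\<dots> = ?K ` ?M"
    unfolding vec_join_kunz_vector irreducible_meets_def by blast
  finally have joins: "{vec_join a b | a b. a \<in> A \<and> b \<in> B0} = ?K ` ?M" .
  have M: "0 \<in> S" "{g2<..} \<subseteq> S" if "S \<in> ?M" for S
    using irreducible_meetsD[OF that assms(2)] by (auto simp: numerical_semigroup_def)
  have "C = ?K ` {S \<in> ?M. \<forall>S'\<in>?M. list_all2 (\<le>) (?K S') (?K S) \<longrightarrow> ?K S' = ?K S}"
    unfolding assms(8) joins minimals_def by (simp add: Compr_image_eq)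
  also have "\<dots> = ?K ` {S \<in> ?M. \<forall>S'\<in>?M. S \<subseteq> S' \<longrightarrow> S' = S}"
    using M by (simp add: kunz_vector_le_iff kunz_vector_eq_iff cong: conj_cong)
  finally have C: "C = ?K ` {S \<in> ?M. \<forall>S'\<in>?M. S \<subseteq> S' \<longrightarrow> S' = S}" .
  have join_eq: "vec_join (?K T) (?K S) = ?K S \<longleftrightarrow> S \<subseteq> T"
    if "S \<in> ?M" "maximal_avoiding g2 T" for S T
  proof -
    have "0 \<in> T" "{g2<..} \<subseteq> T"
      using that(2) maximal_avoiding_greaterThan
      by (auto simp: maximal_avoiding_def numerical_semigroup_def)
    then have "?K (T \<inter> S) = ?K S \<longleftrightarrow> T \<inter> S = S"
      using M[OF that(1)] by (intro kunz_vector_eq_iff) auto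
    then show ?thesis
      by (auto simp: vec_join_kunz_vector)
  qed
  have "D = ?K ` {S \<in> ?M. (\<forall>S'\<in>?M. S \<subseteq> S' \<longrightarrow> S' = S) \<and>
      (\<forall>T. maximal_avoiding g2 T \<and> g1 \<notin> T \<longrightarrow> \<not> S \<subseteq> T)}"
    unfolding assms(9) C B1 using join_eq by auto
  then show ?thesis
    using special_gaps_eq_pair_iff[OF assms(2)] by simp
qed

end
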